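(* Let $s\in\{1,\dots,N_s\}$, and let $\mathcal{F}_s(\lambda_n,\rho_n^s)$ be the local ELBO and $\mathcal{L}_s(\lambda_n)$ the local LM-ELBO of sensor $s$ defined in the context, with $\rho_n^{s*}(\lambda_n)$ the parameter value such that $q_n(\theta_n^s;\rho_n^{s*}(\lambda_n))=q_n^*(\theta_n^s)$. If $\lambda_n^*$ is a global maximiser, a local maximiser, or a stationary point of $\mathcal{L}_s(\lambda_n)$, then $[\lambda_n^*,\rho_n^{s*}(\lambda_n^* )]$ is, respectively, a global maximiser, a local maximiser, or a stationary point of $\mathcal{F}_s(\lambda_n,\rho_n^s)$. In the stationary-point case, the derivatives involved are assumed to exist; a stationary point of $\mathcal{L}_s$ means $\nabla_{\lambda_n}\mathcal{L}_s=0$ at $\lambda_n^*$, and a stationary point of $\mathcal{F}_s$ means that both $\nabla_{\lambda_n}\mathcal{F}_s$ and $\nabla_{\rho_n^s}\mathcal{F}_s$ vanish at $[\lambda_n^*,\rho_n^{s*}(\lambda_n^* )]$.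
   Context: Model (fixed time step $n$). There are $K$ objects with joint state $X_n=(X_{n,1},\dots,X_{n,K})$, each $X_{n,k}$ a real vector, and $N_s$ sensors. Sensor $s$ has given measurements $Y_n^s=(Y_{n,1}^s,\dots,Y_{n,M_n^s}^s)$ and an unknown association vector $\theta_n^s=(\theta_{n,1}^s,\dots,\theta_{n,M_n^s}^s)$ with entries in $\{0,1,\dots,K\}$. Put $\theta_n=(\theta_n^1,\dots,\theta_n^{N_s})$. The likelihood is $p(Y_n^s|\theta_n^s,X_n)=\prod_{j=1}^{M_n^s}\ell^s(Y_{n,j}^s|X_{n,\theta_{n,j}^s})$, where $\ell^s(y|X_{n,k})=\mathcal{N}(y;HX_{n,k},R_k^s)$ (Gaussian density with mean $HX_{n,k}$, $H$ the observation matrix, and covariance $R_k^s$) for $k\ne 0$, and $\ell^s(y|X_{n,0})=1/V^s$ for $k=0$ (clutter uniform on an observation region of volume $V^s$). The association prior is $p(\theta_n^s|M_n^s)=\prod_{j=1}^{M_n^s}p(\theta_{n,j}^s)$ with $p(\theta_{n,j}^s=k)=\Lambda_k^s/\sum_{l=0}^K\Lambda_l^s$, where $\Lambda_0^s$ is the clutter Poisson rate and $\Lambda_k^s$ the Poisson rate of object $k$. $\hat p_n(X_n)=\int p(X_n|X_{n-1})\,q^*_{n-1}(X_{n-1})\,dX_{n-1}$ is the predictive prior density, with $p(X_n|X_{n-1})$ an independent linear Gaussian transition density and $q^*_{n-1}$ the converged variational distribution from the previous time step. Variational distributions: $q_n(X_n;\lambda_n)=\prod_{k=1}^Kq_n(X_{n,k};\lambda_{n,k})$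 with parameter vector $\lambda_n=[\lambda_{n,1},\dots,\lambda_{n,K}]$, and $q_n(\theta_n;\rho_n)=\prod_{s=1}^{N_s}q_n(\theta_n^s;\rho_n^s)$ with parameter vector $\rho_n=[\rho_n^1,\dots,\rho_n^{N_s}]$. Local ELBO: $$\mathcal{F}_s(\lambda_n,\rho_n^s)=\mathrm{E}_{q_n(X_n;\lambda_n)q_n(\theta_n^s;\rho_n^s)}\log p(Y_n^s|\theta_n^s,X_n)+\mathrm{E}_{q_n(\theta_n^s;\rho_n^s)}\log\frac{p(\theta_n^s|M_n^s)}{q_n(\theta_n^s;\rho_n^s)}+\frac1{N_s}\mathrm{E}_{q_n(X_n;\lambda_n)}\log\frac{\hat p_n(X_n)}{q_n(X_n;\lambda_n)}.$$ Optimal association distribution (a function of $\lambda_n$): $q_n^*(\theta_n^s)=\prod_{j=1}^{M_n^s}q_n^*(\theta_{n,j}^s)$, with $q_n^*(\theta_{n,j}^s)\propto p(\theta_{n,j}^s)\exp\big(\mathrm{E}_{q_n(X_n;\lambda_n)}\log\ell^s(Y_{n,j}^s|X_{n,\theta_{n,j}^s})\big)$. Local LM-ELBO: $$\mathcal{L}_s(\lambda_n)=\mathrm{E}_{q_n(X_n;\lambda_n)q_n^*(\theta_n^s)}\log p(Y_n^s|\theta_n^s,X_n)+\mathrm{E}_{q_n^*(\theta_n^s)}\log\frac{p(\theta_n^s|M_n^s)}{q_n^*(\theta_n^s)}+\frac1{N_s}\mathrm{E}_{q_n(X_n;\lambda_n)}\log\frac{\hat p_n(X_n)}{q_n(X_n;\lambda_n)}.$$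 Standing assumption: the assumed form $q_n(\theta_n^s;\rho_n^s)$ includes the optimal distribution $q_n^*(\theta_n^s)$, and $\rho_n^{s*}(\lambda_n)$ denotes the parameter value that reproduces it with $\lambda_n$ held fixed, i.e. $q_n(\theta_n^s;\rho_n^{s*}(\lambda_n))=q_n^*(\theta_n^s)$. *)

theory Defs
  imports "HOL-Probability.Probability"
begin

definition pos_def :: "real^'n^'n \<Rightarrow> bool" where
  "pos_def A \<longleftrightarrow> transpose A = A \<and> (\<forall>x. x \<noteq> 0 \<longrightarrow> 0 < x \<bullet> (A *v x))"

definition mvn_density :: "real^'n \<Rightarrow> real^'n^'n \<Rightarrow> real^'n \<Rightarrow> real" where
  "mvn_density \<mu> S y =
     exp (- ((y - \<mu>) \<bullet> (matrix_inv S *v (y - \<mu>))) / 2) / sqrt ((2 * pi) ^ CARD('n) * det S)"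

definition prob_density :: "('a::euclidean_space \<Rightarrow> real) \<Rightarrow> bool" where
  "prob_density f \<longleftrightarrow>
     f \<in> borel_measurable borel \<and> (\<forall>x. 0 \<le> f x) \<and> (\<integral>\<^sup>+x. ennreal (f x) \<partial>lborel) = 1"

text \<open>
  Data of the tracking problem at the fixed time step. The objects are the elements of the finite
  type \<open>'k\<close>, so a joint state is a vector of type \<open>(real^'d)^'k\<close>; sensors and measurements are
  numbered from 1. The association label 0 (clutter) is \<open>None\<close> and the label of object \<open>k\<close> is
  \<open>Some k\<close>. The transition of object \<open>k\<close> is \<open>N(trans_mat k x + trans_off k, trans_cov k)\<close>.
\<close>

record ('k::finite, 'd::finite, 'm::finite) tracking_model =
  num_sensors :: nat
  num_meas :: "nat \<Rightarrow> nat"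
  meas :: "nat \<Rightarrow> nat \<Rightarrow> real^'m"
  obs_mat :: "real^'d^'m"
  obs_cov :: "nat \<Rightarrow> 'k \<Rightarrow> real^'m^'m"
  obs_vol :: "nat \<Rightarrow> real"
  rate :: "nat \<Rightarrow> 'k option \<Rightarrow> real"
  trans_mat :: "'k \<Rightarrow> real^'d^'d"
  trans_off :: "'k \<Rightarrow> real^'d"
  trans_cov :: "'k \<Rightarrow> real^'d^'d"
  prev_density :: "(real^'d)^'k \<Rightarrow> real"

definition valid_model :: "('k::finite, 'd::finite, 'm::finite) tracking_model \<Rightarrow> bool" where
  "valid_model md \<longleftrightarrow>
     (\<forall>s\<in>{1..num_sensors md}.
        (\<forall>k. pos_def (obs_cov md s k)) \<and> 0 < obs_vol md s \<and> (\<forall>a. 0 < rate md s a)) \<and>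
     (\<forall>k. pos_def (trans_cov md k)) \<and> prob_density (prev_density md)"

definition meas_lik ::
  "('k::finite, 'd::finite, 'm::finite) tracking_model \<Rightarrow> nat \<Rightarrow> real^'m \<Rightarrow> (real^'d)^'k \<Rightarrow> 'k option \<Rightarrow> real" where
  "meas_lik md s y X a =
     (case a of None \<Rightarrow> 1 / obs_vol md s
      | Some k \<Rightarrow> mvn_density (obs_mat md *v (X $ k)) (obs_cov md s k) y)"

text \<open>
  An association vector of sensor \<open>s\<close> is a function on \<open>nat\<close> of which only the values on
  \<open>{1..num_meas md s}\<close> matter; it is \<open>None\<close> elsewhere.
\<close>

definition assoc_vectors ::
  "('k::finite, 'd::finite, 'm::finite) tracking_model \<Rightarrow> nat \<Rightarrow> (nat \<Rightarrow> 'k option) set" where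
  "assoc_vectors md s = PiE_dflt {1..num_meas md s} None (\<lambda>_. UNIV)"

definition likelihood ::
  "('k::finite, 'd::finite, 'm::finite) tracking_model \<Rightarrow> nat \<Rightarrow> (nat \<Rightarrow> 'k option) \<Rightarrow> (real^'d)^'k \<Rightarrow> real" where
  "likelihood md s \<theta> X = (\<Prod>j\<in>{1..num_meas md s}. meas_lik md s (meas md s j) X (\<theta> j))"

definition assoc_prior1 ::
  "('k::finite, 'd::finite, 'm::finite) tracking_model \<Rightarrow> nat \<Rightarrow> 'k option pmf" where
  "assoc_prior1 md s = embed_pmf (\<lambda>a. rate md s a / (\<Sum>b\<in>UNIV. rate md s b))"

definition assoc_prior ::
  "('k::finite, 'd::finite, 'm::finite) tracking_model \<Rightarrow> nat \<Rightarrow> (nat \<Rightarrow> 'k option) pmf" where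
  "assoc_prior md s = Pi_pmf {1..num_meas md s} None (\<lambda>_. assoc_prior1 md s)"

definition transition_density ::
  "('k::finite, 'd::finite, 'm::finite) tracking_model \<Rightarrow> (real^'d)^'k \<Rightarrow> (real^'d)^'k \<Rightarrow> real" where
  "transition_density md X' X =
     (\<Prod>k\<in>UNIV. mvn_density (trans_mat md k *v (X' $ k) + trans_off md k) (trans_cov md k) (X $ k))"

definition pred_prior ::
  "('k::finite, 'd::finite, 'm::finite) tracking_model \<Rightarrow> (real^'d)^'k \<Rightarrow> real" where
  "pred_prior md X = (\<integral>X'. transition_density md X' X * prev_density md X' \<partial>lborel)"

text \<open>
  The parameter vector of the state distribution is \<open>lam :: 'l^'k\<close>, whose entry \<open>lam $ k\<close>
  parametrises the factor of object \<open>k\<close>.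
\<close>

definition mean_field ::
  "('k::finite \<Rightarrow> 'l \<Rightarrow> real^'d::finite \<Rightarrow> real) \<Rightarrow> 'l^'k \<Rightarrow> (real^'d)^'k \<Rightarrow> real" where
  "mean_field q lam X = (\<Prod>k\<in>UNIV. q k (lam $ k) (X $ k))"

definition distr_of :: "('a::euclidean_space \<Rightarrow> real) \<Rightarrow> 'a measure" where
  "distr_of f = density lborel (\<lambda>x. ennreal (f x))"

definition opt_assoc1 ::
  "('k::finite, 'd::finite, 'm::finite) tracking_model \<Rightarrow> nat \<Rightarrow> ((real^'d)^'k \<Rightarrow> real) \<Rightarrow> nat \<Rightarrow> 'k option pmf" where
  "opt_assoc1 md s qX j =
     (let w = (\<lambda>a. pmf (assoc_prior1 md s) a *
                   exp (\<integral>X. ln (meas_lik md s (meas md s j) X a) \<partial>distr_of qX))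
      in embed_pmf (\<lambda>a. w a / (\<Sum>b\<in>UNIV. w b)))"

definition opt_assoc ::
  "('k::finite, 'd::finite, 'm::finite) tracking_model \<Rightarrow> nat \<Rightarrow> ((real^'d)^'k \<Rightarrow> real) \<Rightarrow> (nat \<Rightarrow> 'k option) pmf" where
  "opt_assoc md s qX = Pi_pmf {1..num_meas md s} None (opt_assoc1 md s qX)"

definition elbo ::
  "('k::finite, 'd::finite, 'm::finite) tracking_model \<Rightarrow> nat \<Rightarrow> ((real^'d)^'k \<Rightarrow> real) \<Rightarrow>
   (nat \<Rightarrow> 'k option) pmf \<Rightarrow> real" where
  "elbo md s qX q\<theta> =
     (\<integral>(X, \<theta>). ln (likelihood md s \<theta> X) \<partial>(distr_of qX \<Otimes>\<^sub>M measure_pmf q\<theta>))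
   + (\<integral>\<theta>. ln (pmf (assoc_prior md s) \<theta> / pmf q\<theta> \<theta>) \<partial>measure_pmf q\<theta>)
   + 1 / real (num_sensors md) * (\<integral>X. ln (pred_prior md X / qX X) \<partial>distr_of qX)"

text \<open>
  Existence (as finite numbers) of the expectations over the state in the ELBO and in
  \<open>opt_assoc\<close>; the Bochner integral is 0 for non-integrable functions. The expectations over the
  association vector are finite sums.
\<close>

definition elbo_defined ::
  "('k::finite, 'd::finite, 'm::finite) tracking_model \<Rightarrow> nat \<Rightarrow> ((real^'d)^'k \<Rightarrow> real) \<Rightarrow> bool" where
  "elbo_defined md s qX \<longleftrightarrow>
     (\<forall>j\<in>{1..num_meas md s}. \<forall>a. integrable (distr_of qX) (\<lambda>X. ln (meas_lik md s (meas md s j) X a))) \<and>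
     integrable (distr_of qX) (\<lambda>X. ln (pred_prior md X / qX X))"

definition local_elbo ::
  "('k::finite, 'd::finite, 'm::finite) tracking_model \<Rightarrow> ('k \<Rightarrow> 'l \<Rightarrow> real^'d \<Rightarrow> real) \<Rightarrow>
   (nat \<Rightarrow> 'r \<Rightarrow> (nat \<Rightarrow> 'k option) pmf) \<Rightarrow> nat \<Rightarrow> 'l^'k \<Rightarrow> 'r \<Rightarrow> real" where
  "local_elbo md q qa s lam \<rho> = elbo md s (mean_field q lam) (qa s \<rho>)"

definition local_lm_elbo ::
  "('k::finite, 'd::finite, 'm::finite) tracking_model \<Rightarrow> ('k \<Rightarrow> 'l \<Rightarrow> real^'d \<Rightarrow> real) \<Rightarrow>
   nat \<Rightarrow> 'l^'k \<Rightarrow> real" where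
  "local_lm_elbo md q s lam = elbo md s (mean_field q lam) (opt_assoc md s (mean_field q lam))"

definition global_maximiser :: "('a \<Rightarrow> real) \<Rightarrow> 'a set \<Rightarrow> 'a \<Rightarrow> bool" where
  "global_maximiser f S x \<longleftrightarrow> x \<in> S \<and> (\<forall>y\<in>S. f y \<le> f x)"

definition local_maximiser :: "('a::topological_space \<Rightarrow> real) \<Rightarrow> 'a set \<Rightarrow> 'a \<Rightarrow> bool" where
  "local_maximiser f S x \<longleftrightarrow> x \<in> S \<and> (\<forall>\<^sub>F y in at x within S. f y \<le> f x)"

text \<open>The two \<open>embed_pmf\<close> definitions above denote the intended distributions:\<close>

lemma pmf_embed_normalised:
  fixes w :: "'a::finite \<Rightarrow> real"
  assumes "\<And>a. 0 < w a"
  shows "pmf (embed_pmf (\<lambda>a. w a / (\<Sum>b\<in>UNIV. w b))) a = w a / (\<Sum>b\<in>UNIV. w b)"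
proof -
  have p: "0 < (\<Sum>b\<in>UNIV. w b)" using assms by (intro sum_pos) auto
  have nn: "0 \<le> w a / (\<Sum>b\<in>UNIV. w b)" for a using assms[of a] p by simp
  have "(\<integral>\<^sup>+a. ennreal (w a / (\<Sum>b\<in>UNIV. w b)) \<partial>count_space UNIV)
        = ennreal (\<Sum>a\<in>UNIV. w a / (\<Sum>b\<in>UNIV. w b))"
    using nn by (simp add: nn_integral_count_space_finite sum_ennreal)
  also have "\<dots> = 1" using p by (simp flip: sum_divide_distrib)
  finally show ?thesis using nn by (intro pmf_embed_pmf) auto
qed

lemma pmf_assoc_prior1:
  assumes "valid_model md" "s \<in> {1..num_sensors md}"
  shows "pmf (assoc_prior1 md s) a = rate md s a / (\<Sum>b\<in>UNIV. rate md s b)"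
  unfolding assoc_prior1_def using assms by (intro pmf_embed_normalised) (auto simp: valid_model_def)

lemma pmf_opt_assoc1:
  fixes md :: "('k::finite, 'd::finite, 'm::finite) tracking_model"
  assumes "valid_model md" "s \<in> {1..num_sensors md}"
  defines "w \<equiv> \<lambda>qX j a. pmf (assoc_prior1 md s) a *
                   exp (\<integral>X. ln (meas_lik md s (meas md s j) X a) \<partial>distr_of qX)"
  shows "pmf (opt_assoc1 md s qX j) a = w qX j a / (\<Sum>b\<in>UNIV. w qX j b)"
proof -
  have "0 < rate md s b" for b using assms by (auto simp: valid_model_def)
  then have "0 < w qX j b" for b
    unfolding w_def pmf_assoc_prior1[OF assms(1,2)] by (simp add: sum_pos)
  then show ?thesis
    unfolding opt_assoc1_def Let_def
    using pmf_embed_normalised[of "w qX j"] by (simp add: w_def)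
qed

end

theory Submission
  imports Defs
begin

text \<open>
  For a fixed state distribution the local ELBO depends on the association distribution, up to an
  additive constant, only through its negative relative entropy to the optimal association
  distribution; Gibbs' inequality therefore gives \<open>F\<^sub>s(\<lambda>, \<rho>) \<le> L\<^sub>s(\<lambda>)\<close>, and equality holds at
  \<open>\<rho> = \<rho>\<^sup>*(\<lambda>)\<close> by definition. The statements on maximisers follow at once. At a stationary point
  \<open>\<lambda>\<^sup>*\<close>, the function \<open>L\<^sub>s(\<lambda>) - F\<^sub>s(\<lambda>, \<rho>\<^sup>*(\<lambda>\<^sup>*))\<close> has a local minimum at \<open>\<lambda>\<^sup>*\<close> and
  \<open>F\<^sub>s(\<lambda>\<^sup>*, \<rho>)\<close> has a local maximum at \<open>\<rho>\<^sup>*(\<lambda>\<^sup>*)\<close>, so both gradients of \<open>F\<^sub>s\<close> vanish.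
\<close>

section \<open>Nonvanishing likelihoods and positive priors\<close>

lemma pos_def_det_nonzero:
  assumes "pos_def A"
  shows "det A \<noteq> 0"
proof -
  have "x = 0" if "A *v x = 0" for x
    using assms that unfolding pos_def_def by (metis inner_zero_right less_irrefl)
  then show ?thesis
    unfolding invertible_det_nz[symmetric] invertible_left_inverse matrix_left_invertible_ker by blast
qed

text \<open>Serves the splitting of the log-likelihood by \<open>ln_prod\<close>. For an object
  label the exponential is positive and \<open>sqrt\<close> vanishes only at 0, so a nonzero
  determinant suffices.\<close>

lemma meas_lik_nonzero:
  assumes "valid_model md" "s \<in> {1..num_sensors md}"
  shows "meas_lik md s y X a \<noteq> 0"
proof (cases a)
  case None
  then show ?thesis using assms by (force simp: meas_lik_def valid_model_def)
next
  case (Some k)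
  have "det (obs_cov md s k) \<noteq> 0"
    using assms by (intro pos_def_det_nonzero) (auto simp: valid_model_def)
  then show ?thesis using Some by (simp add: meas_lik_def mvn_density_def)
qed

lemma assoc_prior1_pos:
  assumes "valid_model md" "s \<in> {1..num_sensors md}"
  shows "0 < pmf (assoc_prior1 md s) a"
proof -
  have "0 < rate md s b" for b using assms by (auto simp: valid_model_def)
  then show ?thesis unfolding pmf_assoc_prior1[OF assms] by (simp add: sum_pos)
qed

section \<open>Measurability and the expected log-likelihood\<close>

lemma mean_field_borel_measurable:
  assumes "\<And>k. prob_density (q k (lam $ k))"
  shows "mean_field q lam \<in> borel_measurable borel"
proof -
  have [measurable]: "q k (lam $ k) \<in> borel_measurable borel" for k
    using assms unfolding prob_density_def by blast
  have [measurable]: "(\<lambda>X::(real^'b)^'a. X $ k) \<in> borel_measurable borel" for k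
    by (intro borel_measurable_continuous_onI continuous_intros)
  show ?thesis unfolding mean_field_def by measurable
qed

lemma sigma_finite_distr_of:
  assumes [measurable]: "f \<in> borel_measurable borel"
  shows "sigma_finite_measure (distr_of f)"
  unfolding distr_of_def
  by (subst sigma_finite_measure.sigma_finite_iff_density_finite[OF sigma_finite_lborel]) auto

lemma product_integral:
  fixes f :: "'a \<Rightarrow> real" and g :: "'b \<Rightarrow> real"
  assumes "sigma_finite_measure M" "sigma_finite_measure N"
    and f: "integrable M f" and g: "integrable N g"
  shows "integrable (M \<Otimes>\<^sub>M N) (\<lambda>z. f (fst z) * g (snd z))"
    and "(\<integral>z. f (fst z) * g (snd z) \<partial>(M \<Otimes>\<^sub>M N)) = (\<integral>x. f x \<partial>M) * (\<integral>y. g y \<partial>N)"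
proof -
  interpret pair_sigma_finite M N using assms(1,2) by (rule pair_sigma_finite.intro)
  have [measurable]: "f \<in> borel_measurable M" "g \<in> borel_measurable N" using f g by auto
  show int: "integrable (M \<Otimes>\<^sub>M N) (\<lambda>z. f (fst z) * g (snd z))"
    using f g by (intro Fubini_integrable) (auto simp: abs_mult)
  show "(\<integral>z. f (fst z) * g (snd z) \<partial>(M \<Otimes>\<^sub>M N)) = (\<integral>x. f x \<partial>M) * (\<integral>y. g y \<partial>N)"
    using integral_fst'[OF int] by simp
qed

text \<open>\<open>elbo_defined\<close> provides integrability in the state alone, one measurement
  and one label at a time. Expanding over the finitely many labels with indicators of
  \<open>\<theta> j = a\<close> writes the log-likelihood as a finite sum of products in separated
  variables, to which Fubini applies term by term.\<close>

lemma expected_log_likelihood: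
  fixes md :: "('k::finite, 'd::finite, 'm::finite) tracking_model"
  assumes "valid_model md" "s \<in> {1..num_sensors md}"
    and [measurable]: "qX \<in> borel_measurable borel"
    and "elbo_defined md s qX"
  shows "(\<integral>(X, \<theta>). ln (likelihood md s \<theta> X) \<partial>(distr_of qX \<Otimes>\<^sub>M measure_pmf p)) =
         (\<integral>\<theta>. (\<Sum>j\<in>{1..num_meas md s}. \<integral>X. ln (meas_lik md s (meas md s j) X (\<theta> j)) \<partial>distr_of qX)
            \<partial>measure_pmf p)"
proof -
  let ?J = "{1..num_meas md s}"
  define l where "l j a X = ln (meas_lik md s (meas md s j) X a)" for j a X
  define g :: "nat \<Rightarrow> 'k option \<Rightarrow> (nat \<Rightarrow> 'k option) \<Rightarrow> real"
    where "g j a \<theta> = of_bool (\<theta> j = a)" for j a \<theta>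
  have select: "(\<Sum>a\<in>UNIV. c a * g j a \<theta>) = c (\<theta> j)" for c :: "'k option \<Rightarrow> real" and j \<theta>
    by (simp add: g_def of_bool_def if_distrib cong: if_cong)
  have g: "integrable (measure_pmf p) (g j a)" for j a
    by (rule measure_pmf.integrable_const_bound[where B = 1]) (auto simp: g_def)
  have l: "integrable (distr_of qX) (l j a)" if "j \<in> ?J" for j a
    using assms(4) that unfolding elbo_defined_def l_def by blast
  note prod = product_integral[OF sigma_finite_distr_of[OF assms(3)]
      measure_pmf.sigma_finite_measure_axioms l g]
  have "ln (likelihood md s \<theta> X) = (\<Sum>j\<in>?J. \<Sum>a\<in>UNIV. l j a X * g j a \<theta>)" for X \<theta>
    unfolding select likelihood_def l_def
    using meas_lik_nonzero[OF assms(1,2)] by (intro ln_prod) auto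
  then have "(\<integral>(X, \<theta>). ln (likelihood md s \<theta> X) \<partial>(distr_of qX \<Otimes>\<^sub>M measure_pmf p)) =
        (\<integral>z. (\<Sum>j\<in>?J. \<Sum>a\<in>UNIV. l j a (fst z) * g j a (snd z)) \<partial>(distr_of qX \<Otimes>\<^sub>M measure_pmf p))"
    by (intro Bochner_Integration.integral_cong) auto
  also have "\<dots> = (\<Sum>j\<in>?J. \<Sum>a\<in>UNIV. (\<integral>X. l j a X \<partial>distr_of qX) * (\<integral>\<theta>. g j a \<theta> \<partial>measure_pmf p))"
    using prod by (simp add: Bochner_Integration.integral_sum)
  \<comment> \<open>With the sums back under the integral over \<open>\<theta>\<close>,
    \<open>select\<close> collapses the indicators, now with coefficients already integrated over
    the state.\<close>
  also have "\<dots> = (\<integral>\<theta>. (\<Sum>j\<in>?J. \<Sum>a\<in>UNIV. (\<integral>X. l j a X \<partial>distr_of qX) * g j a \<theta>) \<partial>measure_pmf p)"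
    using g by (simp add: Bochner_Integration.integral_sum)
  finally show ?thesis unfolding select l_def .
qed

section \<open>Gibbs' inequality and the optimal association distribution\<close>

text \<open>Summing \<open>ln t \<le> t - 1\<close> at \<open>t = p/q\<close> over the support of
  \<open>q\<close> leaves the \<open>p\<close>-mass of that support minus 1. Positivity of
  \<open>p\<close> there matters: HOL has \<open>ln 0 = 0\<close> where minus infinity is
  meant.\<close>

lemma gibbs_inequality:
  assumes "finite A" "set_pmf q \<subseteq> A" "\<And>x. x \<in> A \<Longrightarrow> 0 < pmf p x"
  shows "(\<integral>x. ln (pmf p x / pmf q x) \<partial>measure_pmf q) \<le> 0"
proof -
  have fin: "finite (set_pmf q)" using assms(1,2) finite_subset by blast
  have "(\<integral>x. ln (pmf p x / pmf q x) \<partial>measure_pmf q) =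
        (\<Sum>x\<in>set_pmf q. ln (pmf p x / pmf q x) * pmf q x)"
    using fin by (intro integral_measure_pmf_real) auto
  also have "\<dots> \<le> (\<Sum>x\<in>set_pmf q. pmf p x - pmf q x)"
  proof (rule sum_mono)
    fix x assume x: "x \<in> set_pmf q"
    then have pos: "0 < pmf q x" "0 < pmf p x" using assms by (auto simp: pmf_positive)
    then have "ln (pmf p x / pmf q x) * pmf q x \<le> (pmf p x / pmf q x - 1) * pmf q x"
      by (intro mult_right_mono ln_le_minus_one) auto
    then show "ln (pmf p x / pmf q x) * pmf q x \<le> pmf p x - pmf q x"
      using pos by (simp add: left_diff_distrib)
  qed
  also have "\<dots> = measure_pmf.prob p (set_pmf q) - 1"
    using fin by (simp add: sum_subtractf sum_pmf_eq_1 measure_measure_pmf_finite)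
  also have "\<dots> \<le> 0" by simp
  finally show ?thesis .
qed

text \<open>The prior is a product over measurements and the exponential of a sum is a product, so
  the unnormalised optimal weight factorises. \<open>Z\<close> may depend on \<open>qX\<close> but
  not on \<open>\<theta>\<close>, so \<open>ln Z\<close> becomes an additive constant of the
  ELBO.\<close>

lemma pmf_opt_assoc_normalisation:
  fixes md :: "('k::finite, 'd::finite, 'm::finite) tracking_model"
  assumes "valid_model md" "s \<in> {1..num_sensors md}"
  obtains Z where "0 < Z"
    "\<And>\<theta>. \<theta> \<in> assoc_vectors md s \<Longrightarrow> 0 < pmf (assoc_prior md s) \<theta>"
    "\<And>\<theta>. \<theta> \<in> assoc_vectors md s \<Longrightarrow>
       pmf (assoc_prior md s) \<theta> *
       exp (\<Sum>j\<in>{1..num_meas md s}. \<integral>X. ln (meas_lik md s (meas md s j) X (\<theta> j)) \<partial>distr_of qX) =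
       Z * pmf (opt_assoc md s qX) \<theta>"
proof -
  let ?J = "{1..num_meas md s}"
  define w where "w j a = pmf (assoc_prior1 md s) a *
    exp (\<integral>X. ln (meas_lik md s (meas md s j) X a) \<partial>distr_of qX)" for j a
  have w: "0 < w j a" for j a
    using assoc_prior1_pos[OF assms] by (simp add: w_def)
  then have norm: "0 < (\<Sum>b\<in>UNIV. w j b)" for j
    by (intro sum_pos) auto
  have opt: "pmf (opt_assoc1 md s qX j) a = w j a / (\<Sum>b\<in>UNIV. w j b)" for j a
    using pmf_opt_assoc1[OF assms] by (simp add: w_def)
  \<comment> \<open>\<open>Pi_pmf\<close> gives mass only to functions with the default value off
    the index set; \<open>pmf_Pi'\<close> asks for this.\<close>
  have outside: "\<theta> j = None" if "\<theta> \<in> assoc_vectors md s" "j \<notin> ?J" for \<theta> j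
    using that by (auto simp: assoc_vectors_def PiE_dflt_def)
  have prior: "pmf (assoc_prior md s) \<theta> = (\<Prod>j\<in>?J. pmf (assoc_prior1 md s) (\<theta> j))"
    if "\<theta> \<in> assoc_vectors md s" for \<theta>
    unfolding assoc_prior_def by (intro pmf_Pi') (auto simp: outside[OF that])
  have opt_prod: "pmf (opt_assoc md s qX) \<theta> = (\<Prod>j\<in>?J. w j (\<theta> j) / (\<Sum>b\<in>UNIV. w j b))"
    if "\<theta> \<in> assoc_vectors md s" for \<theta>
    unfolding opt_assoc_def opt[symmetric] by (intro pmf_Pi') (auto simp: outside[OF that])
  show thesis
  \<comment> \<open>The witness for \<open>Z\<close> is the product of the normalisers of the single
    measurements.\<close>
  proof (rule that[of "\<Prod>j\<in>?J. \<Sum>b\<in>UNIV. w j b"])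
    show Z: "0 < (\<Prod>j\<in>?J. \<Sum>b\<in>UNIV. w j b)" using norm by (intro prod_pos) auto
    fix \<theta> assume \<theta>: "\<theta> \<in> assoc_vectors md s"
    show "0 < pmf (assoc_prior md s) \<theta>"
      unfolding prior[OF \<theta>] using assoc_prior1_pos[OF assms] by (intro prod_pos) auto
    have "pmf (assoc_prior md s) \<theta> *
        exp (\<Sum>j\<in>?J. \<integral>X. ln (meas_lik md s (meas md s j) X (\<theta> j)) \<partial>distr_of qX) =
        (\<Prod>j\<in>?J. w j (\<theta> j))"
      unfolding prior[OF \<theta>] by (simp add: exp_sum prod.distrib w_def)
    then show "pmf (assoc_prior md s) \<theta> *
        exp (\<Sum>j\<in>?J. \<integral>X. ln (meas_lik md s (meas md s j) X (\<theta> j)) \<partial>distr_of qX) =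
        (\<Prod>j\<in>?J. \<Sum>b\<in>UNIV. w j b) * pmf (opt_assoc md s qX) \<theta>"
      unfolding opt_prod[OF \<theta>] prod_dividef using Z by (simp del: prod_zero_iff prod_pos_nat_iff)
  qed
qed

lemma set_opt_assoc_subset: "set_pmf (opt_assoc md s qX) \<subseteq> assoc_vectors md s"
  unfolding opt_assoc_def assoc_vectors_def
  using set_Pi_pmf_subset'[of "{1..num_meas md s}" None "opt_assoc1 md s qX"]
  by (auto simp: PiE_dflt_def)

lemma elbo_le_opt_assoc:
  fixes md :: "('k::finite, 'd::finite, 'm::finite) tracking_model"
  assumes "valid_model md" "s \<in> {1..num_sensors md}"
    and "qX \<in> borel_measurable borel" "elbo_defined md s qX"
    and p: "set_pmf p \<subseteq> assoc_vectors md s"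
  shows "elbo md s qX p \<le> elbo md s qX (opt_assoc md s qX)"
proof -
  let ?opt = "opt_assoc md s qX"
  define e where "e \<theta> =
    (\<Sum>j\<in>{1..num_meas md s}. \<integral>X. ln (meas_lik md s (meas md s j) X (\<theta> j)) \<partial>distr_of qX)" for \<theta>
  define C where "C = 1 / real (num_sensors md) * (\<integral>X. ln (pred_prior md X / qX X) \<partial>distr_of qX)"
  obtain Z where Z: "0 < Z"
    and prior: "\<And>\<theta>. \<theta> \<in> assoc_vectors md s \<Longrightarrow> 0 < pmf (assoc_prior md s) \<theta>"
    and Z_eq: "\<And>\<theta>. \<theta> \<in> assoc_vectors md s \<Longrightarrow>
      pmf (assoc_prior md s) \<theta> * exp (e \<theta>) = Z * pmf ?opt \<theta>"
    by (rule pmf_opt_assoc_normalisation[OF assms(1,2), of qX, folded e_def]) blast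
  have opt_pos: "0 < pmf ?opt \<theta>" if "\<theta> \<in> assoc_vectors md s" for \<theta>
    using prior[OF that] Z Z_eq[OF that]
    by (metis exp_gt_zero mult_pos_pos zero_less_mult_pos)
  have fin: "finite (assoc_vectors md s)"
    unfolding assoc_vectors_def by auto
  \<comment> \<open>The integral is minus the relative entropy of \<open>r\<close> to
    \<open>?opt\<close>, and \<open>ln Z + C\<close> is the same for all \<open>r\<close>. Comparing
    \<open>r = p\<close> with \<open>r = ?opt\<close> thus leaves only the Gibbs term.\<close>
  have elbo: "elbo md s qX r = ln Z + (\<integral>\<theta>. ln (pmf ?opt \<theta> / pmf r \<theta>) \<partial>measure_pmf r) + C"
    if r: "set_pmf r \<subseteq> assoc_vectors md s" for r
  proof -
    have int: "integrable (measure_pmf r) f" for f :: "_ \<Rightarrow> real"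
      using finite_subset[OF r fin] by (rule integrable_measure_pmf_finite)
    have "(\<integral>\<theta>. e \<theta> \<partial>measure_pmf r) + (\<integral>\<theta>. ln (pmf (assoc_prior md s) \<theta> / pmf r \<theta>) \<partial>measure_pmf r)
        = (\<integral>\<theta>. e \<theta> + ln (pmf (assoc_prior md s) \<theta> / pmf r \<theta>) \<partial>measure_pmf r)"
      using int by simp
    also have "\<dots> = (\<integral>\<theta>. ln Z + ln (pmf ?opt \<theta> / pmf r \<theta>) \<partial>measure_pmf r)"
    \<comment> \<open>Agreement is checked only on the support of \<open>r\<close>, where
      \<open>pmf r \<theta>\<close> is positive and the logarithms split.\<close>
    proof (intro integral_cong_AE AE_pmfI)
      fix \<theta> assume "\<theta> \<in> set_pmf r"
      then have \<theta>: "\<theta> \<in> assoc_vectors md s" and "0 < pmf r \<theta>"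
        using r by (auto simp: pmf_positive)
      then have "e \<theta> + ln (pmf (assoc_prior md s) \<theta> / pmf r \<theta>)
          = ln (pmf (assoc_prior md s) \<theta> * exp (e \<theta>) / pmf r \<theta>)"
        using prior[OF \<theta>] by (simp add: ln_mult ln_div)
      also have "\<dots> = ln Z + ln (pmf ?opt \<theta> / pmf r \<theta>)"
        unfolding Z_eq[OF \<theta>] using Z opt_pos[OF \<theta>] \<open>0 < pmf r \<theta>\<close> by (simp add: ln_mult ln_div)
      finally show "e \<theta> + ln (pmf (assoc_prior md s) \<theta> / pmf r \<theta>)
          = ln Z + ln (pmf ?opt \<theta> / pmf r \<theta>)" .
    qed auto
    also have "\<dots> = ln Z + (\<integral>\<theta>. ln (pmf ?opt \<theta> / pmf r \<theta>) \<partial>measure_pmf r)"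
      using int by simp
    finally show ?thesis
      unfolding elbo_def expected_log_likelihood[OF assms(1-4)] e_def[symmetric] C_def by simp
  qed
  \<comment> \<open>The integrand is 0 everywhere: where \<open>?opt\<close> has no mass,
    \<open>0 / 0 = 0\<close> and \<open>ln 0 = 0\<close>.\<close>
  have "(\<integral>\<theta>. ln (pmf ?opt \<theta> / pmf ?opt \<theta>) \<partial>measure_pmf ?opt) = 0"
    by (simp add: divide_self_if if_distrib[of ln] cong: if_cong)
  then show ?thesis
    using elbo[OF p] elbo[OF set_opt_assoc_subset] gibbs_inequality[OF fin p opt_pos] by simp
qed

section \<open>First-order conditions\<close>

lemma GDERIV_zero_local_max:
  fixes f :: "'a::real_inner \<Rightarrow> real"
  assumes "f differentiable (at x)" "\<forall>\<^sub>F y in at x. f y \<le> f x"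
  shows "GDERIV f x :> 0"
proof -
  obtain f' where f': "(f has_derivative f') (at x)"
    using assms(1) by (auto simp: differentiable_def)
  then show ?thesis
    using has_derivative_local_max[OF f' assms(2)] by (simp add: gderiv_def)
qed

text \<open>Since \<open>f\<close> touches \<open>g\<close> from below at \<open>x\<close>, the
  difference \<open>f - g\<close> has a local maximum there; adding back \<open>g\<close>, whose
  gradient is 0, gives the claim. Used with \<open>g\<close> the local LM-ELBO, it avoids any
  differentiation of \<open>\<rho>s\<close>.\<close>

lemma GDERIV_zero_minorant:
  fixes f g :: "'a::real_inner \<Rightarrow> real"
  assumes "f differentiable (at x)" "GDERIV g x :> 0"
    and "\<forall>\<^sub>F y in at x. f y \<le> g y" "f x = g x"
  shows "GDERIV f x :> 0"
proof -
  have "g differentiable (at x)"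
    using assms(2) by (auto simp: gderiv_def differentiable_def)
  then have "GDERIV (\<lambda>y. f y - g y) x :> 0"
    using assms by (intro GDERIV_zero_local_max) (auto elim: eventually_mono)
  from GDERIV_add[OF this assms(2)] show ?thesis by simp
qed

section \<open>Transfer of maximisers and stationary points\<close>

lemma local_elbo_le_local_lm_elbo:
  assumes "valid_model md" "s \<in> {1..num_sensors md}"
    and "\<And>k. prob_density (q k (lam $ k))" "elbo_defined md s (mean_field q lam)"
    and "set_pmf (qa s \<rho>) \<subseteq> assoc_vectors md s"
  shows "local_elbo md q qa s lam \<rho> \<le> local_lm_elbo md q s lam"
  unfolding local_elbo_def local_lm_elbo_def
  by (intro elbo_le_opt_assoc mean_field_borel_measurable assms)

theorem mainTheorem8:
  fixes md :: "('k::finite, 'd::finite, 'm::finite) tracking_model"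
    and q :: "'k \<Rightarrow> 'l::euclidean_space \<Rightarrow> real^'d \<Rightarrow> real"
    and qa :: "nat \<Rightarrow> 'r::euclidean_space \<Rightarrow> (nat \<Rightarrow> 'k option) pmf"
    and Lam :: "('l^'k) set"
    and P :: "nat \<Rightarrow> 'r set"
    and \<rho>s :: "'l^'k \<Rightarrow> 'r"
    and s :: nat
    and lam0 :: "'l^'k"
  assumes model: "valid_model md"
    and s: "s \<in> {1..num_sensors md}"
    and state_family: "\<And>lam k. lam \<in> Lam \<Longrightarrow> prob_density (q k (lam $ k))"
    and assoc_family: "\<And>\<rho>. \<rho> \<in> P s \<Longrightarrow> set_pmf (qa s \<rho>) \<subseteq> assoc_vectors md s"
    and defined: "\<And>lam. lam \<in> Lam \<Longrightarrow> elbo_defined md s (mean_field q lam)"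
    and optimal: "\<And>lam. lam \<in> Lam \<Longrightarrow>
      \<rho>s lam \<in> P s \<and> qa s (\<rho>s lam) = opt_assoc md s (mean_field q lam)"
  shows "(global_maximiser (local_lm_elbo md q s) Lam lam0 \<longrightarrow>
          global_maximiser (\<lambda>(lam, \<rho>). local_elbo md q qa s lam \<rho>) (Lam \<times> P s) (lam0, \<rho>s lam0))
       \<and> (local_maximiser (local_lm_elbo md q s) Lam lam0 \<longrightarrow>
          local_maximiser (\<lambda>(lam, \<rho>). local_elbo md q qa s lam \<rho>) (Lam \<times> P s) (lam0, \<rho>s lam0))
       \<and> (lam0 \<in> interior Lam \<and> \<rho>s lam0 \<in> interior (P s) \<and>
          (\<lambda>lam. local_elbo md q qa s lam (\<rho>s lam0)) differentiable (at lam0) \<and>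
          (\<lambda>\<rho>. local_elbo md q qa s lam0 \<rho>) differentiable (at (\<rho>s lam0)) \<and>
          GDERIV (local_lm_elbo md q s) lam0 :> 0 \<longrightarrow>
          GDERIV (\<lambda>lam. local_elbo md q qa s lam (\<rho>s lam0)) lam0 :> 0 \<and>
          GDERIV (\<lambda>\<rho>. local_elbo md q qa s lam0 \<rho>) (\<rho>s lam0) :> 0)"
proof -
  let ?F = "local_elbo md q qa s" and ?L = "local_lm_elbo md q s"
  have le: "?F lam \<rho> \<le> ?L lam" if "lam \<in> Lam" "\<rho> \<in> P s" for lam \<rho>
    using that by (intro local_elbo_le_local_lm_elbo model s state_family defined assoc_family)
  have eq: "?F lam (\<rho>s lam) = ?L lam" if "lam \<in> Lam" for lam
    using optimal[OF that] by (simp add: local_elbo_def local_lm_elbo_def)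
  have "global_maximiser (\<lambda>(lam, \<rho>). ?F lam \<rho>) (Lam \<times> P s) (lam0, \<rho>s lam0)"
    if max: "global_maximiser ?L Lam lam0"
  proof -
    have lam0: "lam0 \<in> Lam" using max by (simp add: global_maximiser_def)
    have "?F lam \<rho> \<le> ?F lam0 (\<rho>s lam0)" if "lam \<in> Lam" "\<rho> \<in> P s" for lam \<rho>
      using le[OF that] max that(1) unfolding eq[OF lam0] global_maximiser_def by (meson order_trans)
    then show ?thesis
      using lam0 optimal[OF lam0] by (auto simp: global_maximiser_def)
  qed
  moreover have "local_maximiser (\<lambda>(lam, \<rho>). ?F lam \<rho>) (Lam \<times> P s) (lam0, \<rho>s lam0)"
    if max: "local_maximiser ?L Lam lam0"
  proof -
    have lam0: "lam0 \<in> Lam" using max by (simp add: local_maximiser_def)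
    \<comment> \<open>The filter leaves out \<open>lam0\<close> itself; the inequality there is
      \<open>order_refl\<close>.\<close>
    obtain U where U: "open U" "lam0 \<in> U" "\<And>lam. lam \<in> U \<Longrightarrow> lam \<in> Lam \<Longrightarrow> ?L lam \<le> ?L lam0"
      using max unfolding local_maximiser_def eventually_at_topological by (metis order_refl)
    have "?F lam \<rho> \<le> ?F lam0 (\<rho>s lam0)" if "lam \<in> U" "lam \<in> Lam" "\<rho> \<in> P s" for lam \<rho>
      using le[OF that(2,3)] U(3)[OF that(1,2)] unfolding eq[OF lam0] by (rule order_trans)
    then have "\<forall>\<^sub>F y in at (lam0, \<rho>s lam0) within Lam \<times> P s.
        (case y of (lam, \<rho>) \<Rightarrow> ?F lam \<rho>) \<le> ?F lam0 (\<rho>s lam0)"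
      unfolding eventually_at_topological using U(1,2)
      \<comment> \<open>The bound by \<open>?L\<close> holds for every \<open>\<rho>\<close> in
        \<open>P s\<close>, so the neighbourhood restricts only \<open>lam\<close>.\<close>
      by (intro exI[of _ "U \<times> UNIV"]) (auto intro: open_Times)
    then show ?thesis
      using lam0 optimal[OF lam0] by (simp add: local_maximiser_def)
  qed
  moreover have "GDERIV (\<lambda>lam. ?F lam (\<rho>s lam0)) lam0 :> 0 \<and> GDERIV (?F lam0) (\<rho>s lam0) :> 0"
    if int: "lam0 \<in> interior Lam" "\<rho>s lam0 \<in> interior (P s)"
      and diff: "(\<lambda>lam. ?F lam (\<rho>s lam0)) differentiable (at lam0)"
        "?F lam0 differentiable (at (\<rho>s lam0))"
      and stat: "GDERIV ?L lam0 :> 0"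
  proof
    have mem: "lam0 \<in> Lam" "\<rho>s lam0 \<in> P s"
      using int interior_subset by blast+
    \<comment> \<open>The gradients are taken in the full space while \<open>le\<close> holds only
      on \<open>Lam\<close> and \<open>P s\<close>; interiority makes the comparison valid near both
      points.\<close>
    have near: "\<forall>\<^sub>F lam in at lam0. lam \<in> Lam" "\<forall>\<^sub>F \<rho> in at (\<rho>s lam0). \<rho> \<in> P s"
      using int by (auto simp: eventually_at_topological interior_def)
    show "GDERIV (\<lambda>lam. ?F lam (\<rho>s lam0)) lam0 :> 0"
      by (intro GDERIV_zero_minorant[OF diff(1) stat] eventually_mono[OF near(1)] le eq mem)
    \<comment> \<open>With \<open>lam0\<close> fixed, the constant \<open>?L lam0\<close> bounds
      \<open>?F lam0\<close> on \<open>P s\<close> and is attained at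
      \<open>\<rho>s lam0\<close>.\<close>
    show "GDERIV (?F lam0) (\<rho>s lam0) :> 0"
      by (intro GDERIV_zero_local_max[OF diff(2)] eventually_mono[OF near(2)])
        (simp only: eq le mem)
  qed
  ultimately show ?thesis by blast
qed

end
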